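(* Let $(\mathfrak q,B)$ be a quadratic vector space. Let $\mathfrak g=(\mathbb CX_1\oplus\mathbb CY_1)\oplus\mathfrak q$ and $\mathfrak g'=(\mathbb CX_1'\oplus\mathbb CY_1')\oplus\mathfrak q$ be the double extensions of $\mathfrak q$ by skew-symmetric maps $\overline C$ and $\overline{C'}$ respectively. Then: (1) there exists a Lie algebra isomorphism between $\mathfrak g$ and $\mathfrak g'$ if and only if there exist an invertible linear map $P:\mathfrak q\to\mathfrak q$ and a non-zero $\lambda\in\mathbb C$ such that $\overline{C'}=\lambda P\overline CP^{-1}$ and $P^*P\overline C=\overline C$, where $P^*$ is the adjoint of $P$ with respect to $B$; (2) there exists an i-isomorphism between $\mathfrak g$ and $\mathfrak g'$ if and only if $\overline{C'}$ is in the $\mathrm O(\mathfrak q)$-adjoint orbit through $\lambda\overline C$ for some non-zero $\lambda\in\mathbb C$.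
   Context: All vector spaces are finite-dimensional over $\mathbb C$. A quadratic vector space is a vector space with a non-degenerate symmetric bilinear form. $\mathrm O(\mathfrak q)$ is the isometry group of $(\mathfrak q,B)$, acting on skew-symmetric maps by conjugation (adjoint action). A quadratic Lie algebra is a Lie algebra with a non-degenerate symmetric invariant bilinear form; an i-isomorphism is a Lie algebra isomorphism that is an isometry. The double extension of $(\mathfrak q,B_{\mathfrak q})$ by a skew-symmetric map $\overline C:\mathfrak q\to\mathfrak q$ is the orthogonal direct sum $(\mathbb CX_1\oplus\mathbb CY_1)\oplus\mathfrak q$, with form $B$ extending $B_{\mathfrak q}$ and $B(X_1,X_1)=B(Y_1,Y_1)=0$, $B(X_1,Y_1)=1$, and bracket $[X+\lambda X_1+\mu Y_1,\,Y+\lambda'X_1+\mu'Y_1]=\mu\overline C(Y)-\mu'\overline C(X)+B(\overline C(X),Y)X_1$ for $X,Y\in\mathfrak q$, $\lambda,\mu,\lambda',\mu'\in\mathbb C$. It is a quadratic Lie algebra. *)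

theory Defs
  imports Complex_Main "HOL-Library.Product_Plus"
begin

section \<open>Quadratic vector spaces\<close>

text \<open>The whole type \<open>'a\<close> is the vector space; \<open>Basis\<close> only witnesses finite dimension.\<close>

locale quadratic_vector_space = finite_dimensional_vector_space scale Basis
  for scale :: "complex \<Rightarrow> 'a::ab_group_add \<Rightarrow> 'a" and Basis :: "'a set" +
  fixes B :: "'a \<Rightarrow> 'a \<Rightarrow> complex"
  assumes form_linear: "Vector_Spaces.linear scale (*) (B x)"
    and form_sym: "B x y = B y x"
    and form_nondegenerate: "(\<And>y. B x y = 0) \<Longrightarrow> x = 0"

definition skew_map ::
    "(complex \<Rightarrow> 'a::ab_group_add \<Rightarrow> 'a) \<Rightarrow> ('a \<Rightarrow> 'a \<Rightarrow> complex) \<Rightarrow> ('a \<Rightarrow> 'a) \<Rightarrow> bool" where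
  "skew_map scale B C \<longleftrightarrow>
     Vector_Spaces.linear scale scale C \<and> (\<forall>x y. B (C x) y = - B x (C y))"

definition form_adjoint :: "('a \<Rightarrow> 'a \<Rightarrow> complex) \<Rightarrow> ('a \<Rightarrow> 'a) \<Rightarrow> 'a \<Rightarrow> 'a" where
  "form_adjoint B P = (THE Q. \<forall>x y. B (P x) y = B x (Q y))"

definition isometry_group ::
    "(complex \<Rightarrow> 'a::ab_group_add \<Rightarrow> 'a) \<Rightarrow> ('a \<Rightarrow> 'a \<Rightarrow> complex) \<Rightarrow> ('a \<Rightarrow> 'a) set" where
  "isometry_group scale B =
     {P. Vector_Spaces.linear scale scale P \<and> bij P \<and> (\<forall>x y. B (P x) (P y) = B x y)}"

definition adjoint_orbit ::
    "(complex \<Rightarrow> 'a::ab_group_add \<Rightarrow> 'a) \<Rightarrow> ('a \<Rightarrow> 'a \<Rightarrow> complex) \<Rightarrow> ('a \<Rightarrow> 'a) \<Rightarrow> ('a \<Rightarrow> 'a) set" where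
  "adjoint_orbit scale B D = (\<lambda>P. P \<circ> D \<circ> inv P) ` isometry_group scale B"

context quadratic_vector_space
begin

lemma form_add_right: "B x (y + z) = B x y + B x z"
  and form_scale_right: "B x (scale a y) = a * B x y"
  and form_diff_right: "B x (y - z) = B x y - B x z"
  and form_zero_right: "B x 0 = 0"
proof -
  interpret f: Vector_Spaces.linear scale "(*)" "B x" by (rule form_linear)
  show "B x (y + z) = B x y + B x z" "B x (scale a y) = a * B x y"
    "B x (y - z) = B x y - B x z" "B x 0 = 0"
    by (rule f.add, rule f.scale, rule f.diff, rule f.zero)
qed

lemma form_add_left: "B (x + y) z = B x z + B y z"
  by (metis form_add_right form_sym)

lemma form_scale_left: "B (scale a x) z = a * B x z"
  by (metis form_scale_right form_sym)

lemma form_diff_left: "B (x - y) z = B x z - B y z"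
  by (metis form_diff_right form_sym)

lemma form_zero_left: "B 0 z = 0"
  by (metis form_zero_right form_sym)

lemma form_eqI: "(\<And>x. B x y = B x z) \<Longrightarrow> y = z"
  by (metis form_diff_left form_nondegenerate form_sym right_minus_eq)

lemma form_represents:
  assumes "Vector_Spaces.linear scale (*) f"
  shows "\<exists>y. \<forall>x. B x y = f x"
proof -
  interpret f: Vector_Spaces.linear scale "(*)" f by fact
  define \<Phi> where "\<Phi> x = (\<Sum>b\<in>Basis. scale (B x b) b)" for x
  have lin: "Vector_Spaces.linear scale scale \<Phi>"
    by unfold_locales
      (simp_all add: \<Phi>_def form_add_left form_scale_left scale_left_distrib
        sum.distrib scale_sum_right)
  have agree: "g x = h x"
    if "Vector_Spaces.linear scale (*) g" "Vector_Spaces.linear scale (*) h"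
      "\<And>b. b \<in> Basis \<Longrightarrow> g b = h b" for g h and x
  proof -
    interpret vector_space_pair scale "(*) :: complex \<Rightarrow> complex \<Rightarrow> complex"
      by unfold_locales
    show ?thesis
      using linear_eq_on[OF that(1,2), of x Basis] that(3) span_Basis by auto
  qed
  have coeff: "u b = v b"
    if "(\<Sum>b\<in>Basis. scale (u b) b) = (\<Sum>b\<in>Basis. scale (v b) b)" "b \<in> Basis" for u v b
  proof -
    have "(\<Sum>b\<in>Basis. scale (u b - v b) b) = 0"
      using that(1) by (simp add: scale_left_diff_distrib sum_subtractf)
    then have "u b - v b = 0"
      using independentD[OF independent_Basis finite_Basis order_refl, of "\<lambda>b. u b - v b"] that(2)
      by blast
    then show ?thesis by simp
  qed
  have "inj \<Phi>"
  proof (rule injI)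
    fix x y assume "\<Phi> x = \<Phi> y"
    then have "B x b = B y b" if "b \<in> Basis" for b
      using coeff[of "B x" "B y"] that by (auto simp: \<Phi>_def)
    then have "B x z = B y z" for z
      by (rule agree[OF form_linear form_linear])
    then show "x = y" by (metis form_eqI form_sym)
  qed
  then have "surj \<Phi>" using lin linear_inj_imp_surj by blast
  then obtain y where "\<Phi> y = (\<Sum>b\<in>Basis. scale (f b) b)" by (metis surjD)
  then have "B y b = f b" if "b \<in> Basis" for b
    using coeff[of "B y" f] that by (auto simp: \<Phi>_def)
  then have "B y x = f x" for x
    by (rule agree[OF form_linear assms])
  then show ?thesis by (metis form_sym)
qed

lemma form_adjoint:
  assumes "Vector_Spaces.linear scale scale P"
  shows "B (P x) y = B x (form_adjoint B P y)"
proof -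
  interpret P: Vector_Spaces.linear scale scale P by fact
  have "\<exists>z. \<forall>x. B x z = B (P x) y" for y
    by (rule form_represents, unfold_locales)
      (simp_all add: P.add P.scale form_add_left form_scale_left distrib_left distrib_right)
  then obtain Q where Q: "\<And>x y. B (P x) y = B x (Q y)" by metis
  have "\<forall>x y. B (P x) y = B x (form_adjoint B P y)"
    unfolding form_adjoint_def
  proof (rule theI[of _ Q])
    show "\<forall>x y. B (P x) y = B x (Q y)" using Q by blast
    fix R assume "\<forall>x y. B (P x) y = B x (R y)"
    then show "R = Q" using Q by (intro ext form_eqI) metis
  qed
  then show ?thesis by blast
qed

end

section \<open>Quadratic Lie algebras\<close>

locale lie_algebra = finite_dimensional_vector_space scale Basis
  for scale :: "complex \<Rightarrow> 'a::ab_group_add \<Rightarrow> 'a" and Basis :: "'a set" +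
  fixes br :: "'a \<Rightarrow> 'a \<Rightarrow> 'a"
  assumes br_linear_left: "Vector_Spaces.linear scale scale (\<lambda>x. br x y)"
    and br_linear_right: "Vector_Spaces.linear scale scale (br x)"
    and br_alternating: "br x x = 0"
    and br_jacobi: "br x (br y z) + br y (br z x) + br z (br x y) = 0"

locale quadratic_lie_algebra =
  quadratic_vector_space scale Basis B + lie_algebra scale Basis br
  for scale :: "complex \<Rightarrow> 'a::ab_group_add \<Rightarrow> 'a" and Basis B br +
  assumes form_invariant: "B (br x y) z = B x (br y z)"

definition lie_iso ::
    "(complex \<Rightarrow> 'a::ab_group_add \<Rightarrow> 'a) \<Rightarrow> ('a \<Rightarrow> 'a \<Rightarrow> 'a) \<Rightarrow>
     (complex \<Rightarrow> 'b::ab_group_add \<Rightarrow> 'b) \<Rightarrow> ('b \<Rightarrow> 'b \<Rightarrow> 'b) \<Rightarrow> ('a \<Rightarrow> 'b) \<Rightarrow> bool" where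
  "lie_iso s br s' br' A \<longleftrightarrow>
     Vector_Spaces.linear s s' A \<and> bij A \<and> (\<forall>x y. A (br x y) = br' (A x) (A y))"

definition i_iso ::
    "(complex \<Rightarrow> 'a::ab_group_add \<Rightarrow> 'a) \<Rightarrow> ('a \<Rightarrow> 'a \<Rightarrow> 'a) \<Rightarrow> ('a \<Rightarrow> 'a \<Rightarrow> complex) \<Rightarrow>
     (complex \<Rightarrow> 'b::ab_group_add \<Rightarrow> 'b) \<Rightarrow> ('b \<Rightarrow> 'b \<Rightarrow> 'b) \<Rightarrow> ('b \<Rightarrow> 'b \<Rightarrow> complex) \<Rightarrow>
     ('a \<Rightarrow> 'b) \<Rightarrow> bool" where
  "i_iso s br F s' br' F' A \<longleftrightarrow>
     lie_iso s br s' br' A \<and> (\<forall>x y. F' (A x) (A y) = F x y)"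

section \<open>Double extensions\<close>

text \<open>The triple \<open>(l, m, X)\<close> stands for \<open>X + l X\<^sub>1 + m Y\<^sub>1\<close>.\<close>

type_synonym 'a dext = "complex \<times> complex \<times> 'a"

fun dext_scale :: "(complex \<Rightarrow> 'a \<Rightarrow> 'a) \<Rightarrow> complex \<Rightarrow> 'a dext \<Rightarrow> 'a dext" where
  "dext_scale scale a (l, m, X) = (a * l, a * m, scale a X)"

fun dext_form :: "('a \<Rightarrow> 'a \<Rightarrow> complex) \<Rightarrow> 'a dext \<Rightarrow> 'a dext \<Rightarrow> complex" where
  "dext_form B (l, m, X) (l', m', Y) = l * m' + m * l' + B X Y"

fun dext_bracket ::
    "(complex \<Rightarrow> 'a::ab_group_add \<Rightarrow> 'a) \<Rightarrow> ('a \<Rightarrow> 'a \<Rightarrow> complex) \<Rightarrow> ('a \<Rightarrow> 'a) \<Rightarrow>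
     'a dext \<Rightarrow> 'a dext \<Rightarrow> 'a dext" where
  "dext_bracket scale B C (l, m, X) (l', m', Y) =
     (B (C X) Y, 0, scale m (C Y) - scale m' (C X))"

definition dext_Basis :: "'a::ab_group_add set \<Rightarrow> 'a dext set" where
  "dext_Basis Basis = {(1, 0, 0), (0, 1, 0)} \<union> (\<lambda>X. (0, 0, X)) ` Basis"

context quadratic_vector_space
begin

lemma dext_vector_space: "vector_space (dext_scale scale)"
  by unfold_locales
    (auto simp: algebra_simps scale_left_distrib scale_right_distrib)

lemma dext_finite_dimensional:
  "finite_dimensional_vector_space (dext_scale scale) (dext_Basis Basis)"
proof -
  interpret d: vector_space "dext_scale scale" by (rule dext_vector_space)
  let ?i = "\<lambda>X. (0, 0, X) :: 'a dext"
  let ?e = "(1, 0, 0) :: 'a dext" and ?f = "(0, 1, 0) :: 'a dext"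
  interpret i: Vector_Spaces.linear scale "dext_scale scale" ?i
    by unfold_locales auto
  have im: "d.span (?i ` Basis) = range ?i"
    using i.span_image[of Basis] span_Basis by simp
  have ind: "d.independent (?i ` Basis)"
    by (rule i.independent_injective_image[OF independent_Basis]) (auto intro: inj_onI)
  have f: "?f \<notin> d.span (?i ` Basis)" by (auto simp: im)
  have sp: "d.span (insert ?f (?i ` Basis)) = {x. fst x = 0}"
    unfolding d.span_insert im
    by (auto simp: image_iff zero_prod_def)
  have e: "?e \<notin> d.span (insert ?f (?i ` Basis))" by (simp add: sp)
  show ?thesis
  proof unfold_locales
    show "finite (dext_Basis Basis)" by (simp add: dext_Basis_def finite_Basis)
    show "d.independent (dext_Basis Basis)"
      unfolding dext_Basis_def using d.independent_insertI[OF e d.independent_insertI[OF f ind]]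
      by (simp add: insert_commute)
    have "x \<in> d.span (insert ?e (insert ?f (?i ` Basis)))" for x
      unfolding d.span_insert[of ?e] sp
      by (cases x) (auto intro!: exI[of _ "fst x"])
    then show "d.span (dext_Basis Basis) = UNIV"
      unfolding dext_Basis_def by auto
  qed
qed

lemma dext_quadratic_vector_space:
  "quadratic_vector_space (dext_scale scale) (dext_Basis Basis) (dext_form B)"
proof -
  interpret d: finite_dimensional_vector_space "dext_scale scale" "dext_Basis Basis"
    by (rule dext_finite_dimensional)
  show ?thesis
  proof unfold_locales
    fix x y z :: "'a dext" and a :: complex
    show "dext_form B x (y + z) = dext_form B x y + dext_form B x z"
      by (cases x; cases y; cases z) (simp add: form_add_right algebra_simps)
    show "dext_form B x (dext_scale scale a y) = a * dext_form B x y"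
      by (cases x; cases y) (simp add: form_scale_right algebra_simps)
    show "dext_form B x y = dext_form B y x"
      by (cases x; cases y) (simp add: form_sym algebra_simps)
  next
    fix x :: "'a dext" assume *: "\<And>y. dext_form B x y = 0"
    obtain l m X where x: "x = (l, m, X)" by (cases x)
    have "l = 0" "m = 0"
      using *[of "(0, 1, 0)"] *[of "(1, 0, 0)"] by (simp_all add: x form_zero_right form_zero_left)
    moreover have "X = 0"
      by (rule form_nondegenerate) (use *[of "(0, 0, y)" for y] in \<open>simp add: x form_zero_right\<close>)
    ultimately show "x = 0" by (simp add: x zero_prod_def)
  qed (simp_all add: algebra_simps)
qed

lemma dext_quadratic_lie_algebra:
  assumes "skew_map scale B C"
  shows "quadratic_lie_algebra (dext_scale scale) (dext_Basis Basis) (dext_form B)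
           (dext_bracket scale B C)"
proof -
  interpret d: quadratic_vector_space "dext_scale scale" "dext_Basis Basis" "dext_form B"
    by (rule dext_quadratic_vector_space)
  interpret C: Vector_Spaces.linear scale scale C
    using assms by (simp add: skew_map_def)
  have skew: "B (C x) y = - B x (C y)" for x y
    using assms by (simp add: skew_map_def)
  have alt: "B x (C x) = 0" for x
    using skew[of x x] form_sym[of "C x" x] by simp
  note simps = C.add C.scale C.diff C.zero form_add_right form_scale_right form_diff_right form_zero_right form_zero_left form_add_left
    form_scale_left form_diff_left scale_left_distrib scale_right_distrib
    scale_right_diff_distrib scale_left_diff_distrib
  show ?thesis
  proof unfold_locales
    fix x y z :: "'a dext" and a :: complex
    let ?br = "dext_bracket scale B C"
    show "?br (x + z) y = ?br x y + ?br z y"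
      by (cases x; cases y; cases z) (simp add: simps)
    show "?br y (x + z) = ?br y x + ?br y z"
      by (cases x; cases y; cases z) (simp add: simps)
    show "?br (dext_scale scale a x) y = dext_scale scale a (?br x y)"
      by (cases x; cases y) (simp add: simps mult.commute)
    show "?br y (dext_scale scale a x) = dext_scale scale a (?br y x)"
      by (cases x; cases y) (simp add: simps mult.commute)
    show "?br x x = 0"
      by (cases x) (simp add: skew alt zero_prod_def)
    obtain l m X l' m' Y l'' m'' Z
      where eqs: "x = (l, m, X)" "y = (l', m', Y)" "z = (l'', m'', Z)"
      by (cases x; cases y; cases z)
    have s: "B (C U) (C V) = B (C V) (C U)" for U V
      by (rule form_sym)
    show "?br x (?br y z) + ?br y (?br z x) + ?br z (?br x y) = 0"
      unfolding eqs
      by (simp add: simps zero_prod_def s[of Y X] s[of Z X] s[of Z Y] mult.commute)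
    have "B (C X) Z = - B X (C Z)" by (rule skew)
    moreover have "B (C Y) Z = - B Y (C Z)" by (rule skew)
    moreover have "B (C Y) X = B X (C Y)" by (rule form_sym)
    moreover have "B (C X) Y = - B X (C Y)" by (rule skew)
    moreover have "B (C Y) Z = B Z (C Y)" by (rule form_sym)
    ultimately show "dext_form B (?br x y) z = dext_form B x (?br y z)"
      unfolding eqs by (simp add: simps algebra_simps)
  qed
qed

end

end

theory Submission
  imports Defs
begin

text \<open>
  Write \<open>X\<^sub>1 = (1, 0, 0)\<close> and \<open>Y\<^sub>1 = (0, 1, 0)\<close>. On \<open>\<qq>\<close>, both right-hand sides say that some
  bijection \<open>P\<close> satisfies \<open>C' P = c P C\<close> together with a compatibility of \<open>P\<close> with the form: on the
  image of \<open>C\<close> for Lie isomorphisms, everywhere for i-isomorphisms. Given such a \<open>P\<close>, the block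
  diagonal map \<open>X\<^sub>1 \<mapsto> c X\<^sub>1\<close>, \<open>Y\<^sub>1 \<mapsto> Y\<^sub>1 / c\<close>, \<open>X \<mapsto> P X\<close> is an isomorphism
  (\<open>lie_iso_of_intertwiner\<close>).

  Conversely, let \<open>A\<close> be an isomorphism. If \<open>C = 0\<close>, both algebras are abelian, so \<open>C' = 0\<close> and the
  identity serves as \<open>P\<close>. Let \<open>C \<noteq> 0\<close>. If \<open>A\<close> maps the line of \<open>X\<^sub>1\<close> to itself, then it
  also preserves the hyperplane \<open>\<complex>X\<^sub>1 \<oplus> \<qq>\<close>, because a noncentral \<open>x\<close> lies in that hyperplane exactly
  when \<open>X\<^sub>1 \<in> [x, \<gg>]\<close>; so \<open>A\<close> is block triangular, and \<open>P\<close> is its block on \<open>\<qq>\<close>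
  (\<open>line_stabilizer_block_form\<close>). The brackets determine the form on the image of \<open>C\<close> only up to a
  factor, which a complex square root removes.

  In general \<open>A X\<^sub>1 = \<alpha> X\<^sub>1 + a\<close> with \<open>a \<in> ker C' \<inter> im C'\<close>, and \<open>a\<close> need not vanish. But if \<open>a \<noteq> 0\<close>
  then \<open>C'\<close> has rank two, \<open>C' x = B(a, x) b - B(b, x) a\<close>, and the algebra is governed by the
  decomposable 3-form \<open>B([x, y], z)\<close>, the exterior product of the functionals
  \<open>B(X\<^sub>1, _)\<close>, \<open>B(a, _)\<close> and \<open>B(b, _)\<close>. That 3-form is invariant under \<open>SL\<^sub>2\<close> acting on the span of \<open>X\<^sub>1\<close> and \<open>a\<close>
  and contragrediently on a dual isotropic plane, so some isometric automorphism moves \<open>A X\<^sub>1\<close> back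
  to \<open>X\<^sub>1\<close> (\<open>central_line_normalisation\<close>). Composing with it reduces to the previous case, for Lie
  isomorphisms and i-isomorphisms alike.
\<close>

context quadratic_vector_space
begin

abbreviation dext_lie_iso :: "('a \<Rightarrow> 'a) \<Rightarrow> ('a \<Rightarrow> 'a) \<Rightarrow> ('a dext \<Rightarrow> 'a dext) \<Rightarrow> bool" where
  "dext_lie_iso C C' \<equiv> lie_iso (dext_scale scale) (dext_bracket scale B C)
     (dext_scale scale) (dext_bracket scale B C')"

abbreviation dext_i_iso :: "('a \<Rightarrow> 'a) \<Rightarrow> ('a \<Rightarrow> 'a) \<Rightarrow> ('a dext \<Rightarrow> 'a dext) \<Rightarrow> bool" where
  "dext_i_iso C C' \<equiv> i_iso (dext_scale scale) (dext_bracket scale B C) (dext_form B)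
     (dext_scale scale) (dext_bracket scale B C') (dext_form B)"

section \<open>Intertwining conditions\<close>

lemma skew_map_linear: "skew_map scale B C \<Longrightarrow> Vector_Spaces.linear scale scale C"
  by (simp add: skew_map_def)

lemma skew_map_move: "skew_map scale B C \<Longrightarrow> B (C x) y = - B x (C y)"
  by (simp add: skew_map_def)

lemma skew_map_self: "skew_map scale B C \<Longrightarrow> B (C x) x = 0"
  using skew_map_move[of C x x] form_sym[of "C x" x] by simp

lemma form_minus_left: "B (- x) y = - B x y"
  and form_minus_right: "B x (- y) = - B x y"
  using form_diff_left[of 0 x y] form_diff_right[of x 0 y]
  by (simp_all add: form_zero_left form_zero_right)

lemmas form_simps = form_minus_left form_minus_right form_add_left form_add_right form_diff_left form_diff_right
  form_scale_left form_scale_right form_zero_left form_zero_right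

lemma conjugate_iff_intertwines:
  assumes "bij P"
  shows "C' = (\<lambda>x. scale c (P (C (inv P x)))) \<longleftrightarrow> (\<forall>x. C' (P x) = scale c (P (C x)))"
proof
  assume "C' = (\<lambda>x. scale c (P (C (inv P x))))"
  then show "\<forall>x. C' (P x) = scale c (P (C x))"
    using assms by (simp add: bij_is_inj)
next
  assume r: "\<forall>x. C' (P x) = scale c (P (C x))"
  show "C' = (\<lambda>x. scale c (P (C (inv P x))))"
  proof
    fix x
    show "C' x = scale c (P (C (inv P x)))"
      using r[rule_format, of "inv P x"] assms by (simp add: bij_is_surj surj_f_inv_f)
  qed
qed

lemma adjoint_comp_fixes_iff:
  assumes "Vector_Spaces.linear scale scale P"
  shows "form_adjoint B P \<circ> P \<circ> C = C \<longleftrightarrow> (\<forall>x y. B (P (C x)) (P y) = B (C x) y)"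
proof -
  have "B (P (C x)) (P y) = B y (form_adjoint B P (P (C x)))" for x y
    using form_adjoint[OF assms, of y "P (C x)"] form_sym by metis
  then show ?thesis
    by (auto simp: fun_eq_iff intro!: form_eqI) (metis form_sym)+
qed

lemma adjoint_orbit_scaled_iff:
  "C' \<in> adjoint_orbit scale B (\<lambda>x. scale c (C x)) \<longleftrightarrow>
   (\<exists>P. Vector_Spaces.linear scale scale P \<and> bij P \<and> (\<forall>x y. B (P x) (P y) = B x y) \<and>
        (\<forall>x. C' (P x) = scale c (P (C x))))"
proof -
  have "P \<circ> (\<lambda>x. scale c (C x)) \<circ> inv P = (\<lambda>x. scale c (P (C (inv P x))))"
    if "Vector_Spaces.linear scale scale P" for P
  proof -
    interpret P: Vector_Spaces.linear scale scale P by fact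
    show ?thesis by (simp add: fun_eq_iff P.scale)
  qed
  then show ?thesis
    using conjugate_iff_intertwines[of _ C' c C]
    by (auto simp: adjoint_orbit_def isometry_group_def image_iff)
qed

section \<open>From intertwiners to isomorphisms of double extensions\<close>

text \<open>
  The scalar on \<open>Y\<^sub>1\<close> must be \<open>1 / c\<close> for \<open>[Y\<^sub>1, X]\<close> to be respected, and the form condition then
  forces the scalar \<open>c\<close> on \<open>X\<^sub>1\<close> through \<open>[X, Y] = B(C X, Y) X\<^sub>1\<close>. These two scalars are inverse, so
  the map is an isometry as soon as \<open>P\<close> is one.
\<close>

lemma lie_iso_of_intertwiner:
  assumes P: "Vector_Spaces.linear scale scale P" "bij P" and c: "c \<noteq> 0"
    and C': "\<And>x. C' (P x) = scale c (P (C x))"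
    and form: "\<And>x y. B (P (C x)) (P y) = B (C x) y"
  shows "dext_lie_iso C C' (\<lambda>(l, m, X). (c * l, m / c, P X))"
    (is "dext_lie_iso _ _ ?A")
proof -
  interpret P: Vector_Spaces.linear scale scale P by fact
  interpret d: vector_space "dext_scale scale" by (rule dext_vector_space)
  show ?thesis
    unfolding lie_iso_def
  proof (intro conjI allI)
    show "Vector_Spaces.linear (dext_scale scale) (dext_scale scale) ?A"
      by unfold_locales
        (auto simp: P.add P.scale algebra_simps add_divide_distrib)
    show "bij ?A"
      by (rule o_bij[where g = "\<lambda>(l, m, X). (l / c, c * m, inv P X)"])
        (use P(2) c in \<open>auto simp: fun_eq_iff bij_is_inj bij_is_surj surj_f_inv_f\<close>)
    fix x y :: "'a dext"
    show "?A (dext_bracket scale B C x y) = dext_bracket scale B C' (?A x) (?A y)"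
      using c by (cases x; cases y) (simp add: C' P.diff P.scale form form_simps)
  qed
qed

section \<open>Isomorphisms preserving the central line\<close>

text \<open>
  The component \<open>f\<close> of \<open>A X\<close> along \<open>Y\<^sub>1\<close> vanishes for \<open>X \<in> \<qq>\<close>: when \<open>C X \<noteq> 0\<close> some \<open>[X, Y]\<close> is a
  nonzero multiple of \<open>X\<^sub>1\<close>, whereas no bracket with an element outside \<open>\<complex>X\<^sub>1 \<oplus> \<qq>\<close> is one. Then
  \<open>A\<close> is block triangular with diagonal blocks \<open>\<alpha>\<close>, \<open>P\<close>, \<open>\<beta>\<close>, and comparing brackets gives
  \<open>c = 1 / \<beta>\<close> and \<open>\<kappa> = \<alpha> \<beta>\<close>. The last conclusion is what makes \<open>P\<close> an isometry when \<open>A\<close> is one.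
\<close>

lemma line_stabilizer_block_form:
  assumes skew: "skew_map scale B C" "skew_map scale B C'"
    and A: "dext_lie_iso C C' A"
    and nz: "C u \<noteq> 0"
    and line: "A (1, 0, 0) = (\<alpha>, 0, 0)"
  obtains P c \<kappa> where "Vector_Spaces.linear scale scale P" "bij P" "c \<noteq> 0" "\<kappa> \<noteq> 0"
    "\<forall>x. C' (P x) = scale c (P (C x))"
    "\<forall>x y. B (P (C x)) (P y) = \<kappa> * B (C x) y"
    "\<forall>x. \<exists>g. A (0, 0, x) = (g, 0, P x)"
proof -
  interpret C: Vector_Spaces.linear scale scale C using skew(1) by (rule skew_map_linear)
  interpret C': Vector_Spaces.linear scale scale C' using skew(2) by (rule skew_map_linear)
  interpret A: Vector_Spaces.linear "dext_scale scale" "dext_scale scale" A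
    using A by (simp add: lie_iso_def)
  have bijA: "bij A" and hom: "\<And>x y. A (dext_bracket scale B C x y)
      = dext_bracket scale B C' (A x) (A y)"
    using A by (auto simp: lie_iso_def)
  have "\<alpha> \<noteq> 0"
  proof
    assume "\<alpha> = 0"
    then have "A (1, 0, 0) = A 0" using line by (simp add: A.zero[unfolded zero_prod_def] zero_prod_def)
    then show False using bijA by (simp add: bij_is_inj inj_eq zero_prod_def)
  qed
  have line': "A (l, 0, 0) = (l * \<alpha>, 0, 0)" for l
    using A.scale[of l "(1, 0, 0)"] line by simp
  define f where "f x = fst (snd (A (0, 0, x)))" for x
  define g where "g x = fst (A (0, 0, x))" for x
  define P where "P x = snd (snd (A (0, 0, x)))" for x
  have Aq: "A (0, 0, x) = (g x, f x, P x)" for x by (simp add: f_def g_def P_def)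
  have add: "A (0, 0, x + y) = A (0, 0, x) + A (0, 0, y)" for x y
    using A.add[of "(0, 0, x)" "(0, 0, y)"] by simp
  have sc: "A (0, 0, scale k x) = dext_scale scale k (A (0, 0, x))" for x k
    using A.scale[of k "(0, 0, x)"] by simp
  have bracket: "A (B (C x) y, 0, 0)
      = (B (C' (P x)) (P y), 0, scale (f x) (C' (P y)) - scale (f y) (C' (P x)))" for x y
    using hom[of "(0, 0, x)" "(0, 0, y)"] by (simp add: Aq)
  have f0: "f x = 0" if Cx: "C x \<noteq> 0" for x
  proof (rule ccontr)
    assume m: "f x \<noteq> 0"
    obtain y where y: "B (C x) y \<noteq> 0" using Cx form_nondegenerate by blast
    have b: "B (C' (P x)) (P y) \<noteq> 0"
      "scale (f x) (C' (P y)) = scale (f y) (C' (P x))"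
      using bracket[of x y] y \<open>\<alpha> \<noteq> 0\<close> by (auto simp: line')
    have "f x * B (C' (P x)) (P y) = - B (P x) (scale (f x) (C' (P y)))"
      by (simp add: skew_map_move[OF skew(2)] form_simps)
    also have "\<dots> = - f y * B (C' (P x)) (P x)"
      unfolding b by (simp add: form_simps form_sym)
    finally show False using m b(1) by (simp add: skew_map_self[OF skew(2)])
  qed
  \<comment> \<open>The vectors outside \<open>ker C\<close> span \<open>\<qq>\<close>, so the kernel of \<open>C\<close> is reached by translating with \<open>u\<close>.\<close>
  have f: "f x = 0" for x
  proof (cases "C x = 0")
    case True
    then have "f (x + u) = 0" "f u = 0" using nz f0 by (auto simp: C.add)
    then show ?thesis using add[of x u] by (simp add: Aq)
  qed (rule f0)
  have linP: "Vector_Spaces.linear scale scale P"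
    by unfold_locales (use add sc in \<open>simp_all add: Aq\<close>)
  interpret P: Vector_Spaces.linear scale scale P by fact
  have "inj P"
  proof (rule injI)
    fix x y assume "P x = P y"
    have "A ((g y - g x) / \<alpha>, 0, x) = A (0, 0, y)"
      using A.add[of "((g y - g x) / \<alpha>, 0, 0)" "(0, 0, x)"] \<open>\<alpha> \<noteq> 0\<close> \<open>P x = P y\<close>
      by (simp add: line' Aq f)
    then show "x = y" using bijA by (simp add: bij_is_inj inj_eq)
  qed
  then have bijP: "bij P" using linP linear_inj_imp_surj by (simp add: bij_def)
  obtain e \<beta> U where Y: "A (0, 1, 0) = (e, \<beta>, U)" by (cases "A (0, 1, 0)")
  have "\<beta> \<noteq> 0"
  proof
    assume \<beta>: "\<beta> = 0"
    obtain l m x where lmx: "A (l, m, x) = (0, 1, 0)" using bijA by (metis bij_pointE prod_cases3)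
    have "A (l, m, x) = A (l, 0, 0) + dext_scale scale m (A (0, 1, 0)) + A (0, 0, x)"
      using A.add[of "(l, m, 0)" "(0, 0, x)"] A.add[of "(l, 0, 0)" "(0, m, 0)"]
        A.scale[of m "(0, 1, 0)"] by simp
    then show False by (simp add: lmx line' Y Aq f \<beta>)
  qed
  have "P (C x) = scale \<beta> (C' (P x))" for x
    using hom[of "(0, 1, 0)" "(0, 0, x)"] by (simp add: Y Aq f form_simps C.zero)
  then have inter: "C' (P x) = scale (1 / \<beta>) (P (C x))" for x
    using \<open>\<beta> \<noteq> 0\<close> by simp
  have "B (P (C x)) (P y) = (\<alpha> * \<beta>) * B (C x) y" for x y
    using bracket[of x y] \<open>\<beta> \<noteq> 0\<close> by (simp add: line' inter form_simps field_simps)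
  then show thesis
    using that[OF linP bijP, of "1 / \<beta>" "\<alpha> * \<beta>"] inter f \<open>\<alpha> \<noteq> 0\<close> \<open>\<beta> \<noteq> 0\<close>
    by (auto simp: Aq)
qed

section \<open>Moving the central line back\<close>

text \<open>
  The vectors \<open>a\<close>, \<open>w\<close> form a hyperbolic pair orthogonal to \<open>b\<close>. The automorphism is the identity
  on the orthogonal complement of \<open>X\<^sub>1\<close>, \<open>Y\<^sub>1\<close>, \<open>a\<close>, \<open>w\<close>; on the span of \<open>X\<^sub>1\<close> and \<open>a\<close> it is the map
  \<open>X\<^sub>1 \<mapsto> - a\<close>, \<open>a \<mapsto> X\<^sub>1 + \<alpha> a\<close> of determinant 1, and being an isometry it must then send
  \<open>Y\<^sub>1 \<mapsto> \<alpha> Y\<^sub>1 - w\<close> and \<open>w \<mapsto> Y\<^sub>1\<close>. Determinant 1 is what makes it preserve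
  \<open>X\<^sub>1 \<and> a \<and> b\<close>, hence the bracket.
\<close>

lemma rank_two_automorphism:
  assumes a: "B a a = 0" and w: "B w w = 0" "B a w = 1"
    and b: "B a b = 0" "B b w = 0"
    and C: "\<And>x. C x = scale (B a x) b - scale (B b x) a"
  obtains T where
    "dext_i_iso C C T"
    "T (\<alpha>, 0, a) = (1, 0, 0)"
proof -
  interpret d: quadratic_vector_space "dext_scale scale" "dext_Basis Basis" "dext_form B"
    by (rule dext_quadratic_vector_space)
  have sym: "B w a = 1" "B b a = 0" "B w b = 0" using w b form_sym by metis+
  \<comment> \<open>The formula comes from decomposing \<open>X = B(w, X) a + B(a, X) w + X\<^sub>0\<close> with \<open>X\<^sub>0\<close> orthogonal to \<open>a\<close> and \<open>w\<close>.\<close>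
  define T where "T = (\<lambda>(l, m, X). (B w X, m * \<alpha> + B a X,
      X + scale (\<alpha> * B w X - l - B w X) a - scale (m + B a X) w))"
  have lin: "Vector_Spaces.linear (dext_scale scale) (dext_scale scale) T"
    by unfold_locales
      (auto simp: T_def form_simps algebra_simps scale_left_distrib scale_right_distrib
        scale_left_diff_distrib scale_right_diff_distrib)
  have isom: "dext_form B (T x) (T y) = dext_form B x y" for x y
  proof -
    obtain l m X l' m' Y where xy: "x = (l, m, X)" "y = (l', m', Y)" by (cases x; cases y)
    have "B X a = B a X" "B X w = B w X" by (rule form_sym)+
    then show ?thesis
      unfolding xy by (simp add: T_def form_simps a w b sym algebra_simps)
  qed
  have "inj T"
    by (rule injI, rule d.form_eqI) (metis isom d.form_sym)
  then have "bij T"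
    using lin d.linear_inj_imp_surj by (simp add: bij_def)
  moreover have "T (dext_bracket scale B C x y) = dext_bracket scale B C (T x) (T y)" for x y
    by (cases x; cases y) (simp add: T_def C form_simps a w b sym algebra_simps scale_left_distrib
       scale_right_distrib scale_left_diff_distrib scale_right_diff_distrib)
  moreover have "T (\<alpha>, 0, a) = (1, 0, 0)"
    by (simp add: T_def a w sym)
  ultimately show thesis
    using that lin isom unfolding i_iso_def lie_iso_def by blast
qed

text \<open>
  Since \<open>X\<^sub>1\<close> is a central commutator, so is \<open>A X\<^sub>1 = \<alpha> X\<^sub>1 + a\<close>, whence \<open>a \<in> ker C' \<inter> im C'\<close>.
  Suppose \<open>a \<noteq> 0\<close>. Then \<open>A\<close> moves some \<open>x\<^sub>0 \<in> \<qq>\<close> out of the hyperplane \<open>\<complex>X\<^sub>1 \<oplus> \<qq>\<close>. As the brackets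
  of \<open>x\<^sub>0\<close> with this hyperplane are multiples of \<open>X\<^sub>1\<close>, their images control \<open>C'\<close> on a
  hyperplane of \<open>\<qq>\<close>, which turns out to be the orthogonal complement of \<open>a\<close>: \<open>C'\<close> maps it into the
  line of \<open>a\<close>. By skew-symmetry \<open>C'\<close> is then the rank-two map handled above, with \<open>b = C' w\<close> for any
  isotropic \<open>w\<close> with \<open>B(a, w) = 1\<close>.
\<close>

lemma central_line_normalisation:
  assumes skew: "skew_map scale B C" "skew_map scale B C'"
    and A: "dext_lie_iso C C' A"
    and nz: "C u \<noteq> 0"
  obtains T \<gamma> where
    "dext_i_iso C' C' T"
    "T (A (1, 0, 0)) = (\<gamma>, 0, 0)"
proof -
  interpret C: Vector_Spaces.linear scale scale C using skew(1) by (rule skew_map_linear)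
  interpret C': Vector_Spaces.linear scale scale C' using skew(2) by (rule skew_map_linear)
  interpret d: vector_space "dext_scale scale" by (rule dext_vector_space)
  interpret A: Vector_Spaces.linear "dext_scale scale" "dext_scale scale" A
    using A by (simp add: lie_iso_def)
  have bijA: "bij A" and hom: "\<And>x y. A (dext_bracket scale B C x y)
      = dext_bracket scale B C' (A x) (A y)"
    using A by (auto simp: lie_iso_def)
  obtain \<alpha> \<mu> a where X1: "A (1, 0, 0) = (\<alpha>, \<mu>, a)" by (cases "A (1, 0, 0)")
  obtain v0 where "B (C u) v0 \<noteq> 0" using nz form_nondegenerate by blast
  then obtain v where v: "B (C u) v = 1"
    using form_scale_right[of "C u" "1 / B (C u) v0" v0] by auto
  obtain g1 m1 U where Au: "A (0, 0, u) = (g1, m1, U)" by (cases "A (0, 0, u)")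
  obtain g2 m2 V where Av: "A (0, 0, v) = (g2, m2, V)" by (cases "A (0, 0, v)")
  have "A (1, 0, 0) = (B (C' U) V, 0, scale m1 (C' V) - scale m2 (C' U))"
    using hom[of "(0, 0, u)" "(0, 0, v)"] by (simp add: Au Av v)
  then have \<mu>: "\<mu> = 0" and a: "a = scale m1 (C' V) - scale m2 (C' U)" by (simp_all add: X1)
  obtain x where "A x = (0, 1, 0)" using bijA by (metis bij_pointE)
  then have "A (dext_bracket scale B C (1, 0, 0) x) = (0, 0, - C' a)"
    using hom[of "(1, 0, 0)" x] by (simp add: X1 \<mu> C'.zero form_zero_right)
  moreover have "dext_bracket scale B C (1, 0, 0) x = 0"
    by (cases x) (simp add: C.zero form_zero_left zero_prod_def)
  ultimately have Ca: "C' a = 0" by (simp add: A.zero[unfolded zero_prod_def] zero_prod_def)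
  show thesis
  proof (cases "a = 0")
    case True
    have "dext_i_iso C' C' id"
      by (simp add: i_iso_def lie_iso_def d.linear_id)
    then show thesis using that[of id \<alpha>] by (simp add: X1 \<mu> True)
  next
    case False
    define p where "p = scale m1 V - scale m2 U"
    have p: "C' p = a" by (simp add: p_def a C'.diff C'.scale)
    have ap: "B a p = 0" using skew_map_self[OF skew(2), of p] by (simp add: p)
    have aa: "B a a = 0" using skew_map_move[OF skew(2), of p a] by (simp add: p Ca form_simps)
    \<comment> \<open>If \<open>A\<close> kept both \<open>u\<close> and \<open>v\<close> in the hyperplane, then \<open>A X\<^sub>1 = [A u, A v]\<close> would have \<open>a = 0\<close>.\<close>
    obtain x0 g m W where x0: "A (0, 0, x0) = (g, m, W)" and m: "m \<noteq> 0"
    proof (cases "m1 = 0")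
      case True
      then have "m2 \<noteq> 0" using a False by auto
      then show thesis using that Av by blast
    qed (use that Au in blast)
    define z where "z = snd (snd (A (0, 0, C x0)))"
    \<comment> \<open>Both sides are \<open>\<qq>\<close>-components of \<open>A [x\<^sub>0, (l, t, y)]\<close>; a nonzero \<open>t\<close> is the only obstruction to
      \<open>C' x\<close> lying on the line of \<open>a\<close>.\<close>
    have key: "scale m (C' x) = scale (B (C x0) y) a - scale t z"
      if "A (l, t, y) = (0, 0, x)" for l t x y
    proof -
      have "A (B (C x0) y, 0, - scale t (C x0))
          = dext_scale scale (B (C x0) y) (A (1, 0, 0)) - dext_scale scale t (A (0, 0, C x0))"
        using A.diff[of "(B (C x0) y, 0, 0)" "(0, 0, scale t (C x0))"]
          A.scale[of "B (C x0) y" "(1, 0, 0)"] A.scale[of t "(0, 0, C x0)"] by simp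
      moreover have "A (B (C x0) y, 0, - scale t (C x0)) = (B (C' W) x, 0, scale m (C' x))"
        using hom[of "(0, 0, x0)" "(l, t, y)"] by (simp add: x0 that)
      ultimately show ?thesis
        by (cases "A (0, 0, C x0)") (simp add: X1 z_def)
    qed
    \<comment> \<open>Pairing \<open>key\<close> with \<open>p\<close> kills its \<open>a\<close>-term, so \<open>B(x, a)\<close> is proportional to \<open>t\<close>; the factor
      is nonzero because \<open>a\<close> is not orthogonal to everything.\<close>
    have pair: "m * B x a = t * B z p" if "A (l, t, y) = (0, 0, x)" for l t x y
    proof -
      have "- (m * B x a) = B (scale m (C' x)) p"
        using skew_map_move[OF skew(2), of x p] by (simp add: form_simps p)
      then show ?thesis by (simp add: key[OF that] form_simps ap)
    qed
    have onto: "\<exists>l t y. A (l, t, y) = (0, 0, x)" for x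
      using bijA by (metis bij_pointE prod_cases3)
    have zp: "B z p \<noteq> 0"
    proof
      assume "B z p = 0"
      then have "B x a = 0" for x using pair onto[of x] m by fastforce
      then show False using False form_nondegenerate form_sym by metis
    qed
    have perp: "\<exists>k. C' x = scale k a" if "B x a = 0" for x
    proof -
      obtain l t y where lty: "A (l, t, y) = (0, 0, x)" using onto by blast
      then have "t = 0" using pair[OF lty] that zp by simp
      then have "scale m (C' x) = scale (B (C x0) y) a" using key[OF lty] by simp
      then have "C' x = scale (B (C x0) y / m) a"
        using m by (metis divide_inverse_commute scale_scale left_inverse scale_one)
      then show ?thesis by blast
    qed
    obtain w0 where "B a w0 \<noteq> 0" using False form_nondegenerate by blast
    then obtain w1 where w1: "B a w1 = 1"
      using form_scale_right[of a "1 / B a w0" w0] by auto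
    \<comment> \<open>Adding a multiple of the isotropic vector \<open>a\<close> makes the dual vector isotropic.\<close>
    define w where "w = w1 - scale (B w1 w1 / 2) a"
    have w: "B a w = 1" "B w w = 0"
      using form_sym[of w1 a] by (simp_all add: w_def form_simps w1 aa)
    define b where "b = C' w"
    have b: "B a b = 0" "B b w = 0"
      using skew_map_move[OF skew(2), of a w] skew_map_self[OF skew(2), of w]
      by (simp_all add: b_def Ca form_simps)
    have "C' x = scale (B a x) b - scale (B b x) a" for x
    proof -
      define x' where "x' = x - scale (B a x) w"
      have "B x' a = 0" using form_sym[of x a] form_sym[of w a] by (simp add: x'_def form_simps w)
      then obtain k where k: "C' x' = scale k a" using perp by blast
      have "k = B (C' x') w" by (simp add: k form_simps w)
      also have "\<dots> = - B x' b" by (simp add: skew_map_move[OF skew(2)] b_def)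
      also have "\<dots> = - B b x"
        using b form_sym[of x b] form_sym[of w b] by (simp add: x'_def form_simps)
      finally have "C' x' = - scale (B b x) a" using k by simp
      moreover have "C' x' = C' x - scale (B a x) b" by (simp add: x'_def C'.diff C'.scale b_def)
      ultimately show ?thesis by (simp add: algebra_simps)
    qed
    from rank_two_automorphism[OF aa w(2,1) b this, of \<alpha>] that show thesis
      unfolding X1 \<mu> by blast
  qed
qed

text \<open>The target is abelian like the source, whereas \<open>[Y\<^sub>1, X] = C' X\<close>.\<close>

lemma abelian_double_extension_rigid:
  assumes skew: "skew_map scale B C'"
    and A: "dext_lie_iso (\<lambda>x. 0) C' A"
  shows "C' x = 0"
proof -
  interpret C': Vector_Spaces.linear scale scale C' using skew by (rule skew_map_linear)
  interpret A: Vector_Spaces.linear "dext_scale scale" "dext_scale scale" A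
    using A by (simp add: lie_iso_def)
  have "surj A" and hom: "\<And>x y. A (dext_bracket scale B (\<lambda>x. 0) x y)
      = dext_bracket scale B C' (A x) (A y)"
    using A by (auto simp: lie_iso_def bij_is_surj)
  obtain y z where "A y = (0, 1, 0)" "A z = (0, 0, x)" using \<open>surj A\<close> by (metis surjD)
  then have "(0, 0, C' x) = A (dext_bracket scale B (\<lambda>x. 0) y z)"
    using hom[of y z] by (simp add: C'.zero form_zero_left)
  also have "dext_bracket scale B (\<lambda>x. 0) y z = 0"
    by (cases y; cases z) (simp add: form_zero_left zero_prod_def)
  finally show ?thesis by (simp add: A.zero[unfolded zero_prod_def] zero_prod_def)
qed

section \<open>From isomorphisms to intertwiners\<close>

lemma lie_iso_comp:
  assumes "lie_iso s br s' br' A" "lie_iso s' br' s'' br'' T"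
  shows "lie_iso s br s'' br'' (T \<circ> A)"
  using assms Vector_Spaces.linear_compose[of s s' A s'' T]
  by (auto simp: lie_iso_def intro: bij_comp)

text \<open>
  Dividing \<open>P\<close> by a square root of \<open>\<kappa>\<close> normalises the form condition and leaves the
  intertwining relation \<open>C' P = c P C\<close> unchanged.
\<close>

lemma intertwiner_of_lie_iso:
  assumes skew: "skew_map scale B C" "skew_map scale B C'"
    and A: "dext_lie_iso C C' A"
  obtains P c where "Vector_Spaces.linear scale scale P" "bij P" "c \<noteq> 0"
    "\<And>x. C' (P x) = scale c (P (C x))"
    "\<And>x y. B (P (C x)) (P y) = B (C x) y"
proof (cases "\<exists>u. C u \<noteq> 0")
  case False
  then have "C = (\<lambda>x. 0)" by auto
  then show thesis
    using that[of id 1] linear_id abelian_double_extension_rigid[OF skew(2), of A] A by simp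
next
  case True
  then obtain u where u: "C u \<noteq> 0" by blast
  obtain T \<gamma> where T: "dext_i_iso C' C' T"
    "(T \<circ> A) (1, 0, 0) = (\<gamma>, 0, 0)"
    using central_line_normalisation[OF skew A u] by auto
  have TA: "dext_lie_iso C C' (T \<circ> A)"
    using lie_iso_comp A T(1) by (auto simp: i_iso_def)
  obtain P c \<kappa> where P: "Vector_Spaces.linear scale scale P" "bij P" "c \<noteq> 0" "\<kappa> \<noteq> 0"
    "\<forall>x. C' (P x) = scale c (P (C x))"
    "\<forall>x y. B (P (C x)) (P y) = \<kappa> * B (C x) y"
    "\<forall>x. \<exists>g. (T \<circ> A) (0, 0, x) = (g, 0, P x)"
    by (rule line_stabilizer_block_form[OF skew TA u T(2)]) (rule that)
  interpret P: Vector_Spaces.linear scale scale P by fact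
  interpret C': Vector_Spaces.linear scale scale C' using skew(2) by (rule skew_map_linear)
  define r where "r = 1 / csqrt \<kappa>"
  have r: "r \<noteq> 0" "r * r * \<kappa> = 1"
    using P(4) power2_csqrt[of \<kappa>] by (simp_all add: r_def power2_eq_square)
  define Q where "Q x = scale r (P x)" for x
  have linQ: "Vector_Spaces.linear scale scale Q"
    by unfold_locales (simp_all add: Q_def P.add P.scale scale_right_distrib mult.commute)
  have "inj Q" using r P(2) by (auto simp: inj_def Q_def bij_def)
  then have "bij Q" using linQ linear_inj_imp_surj by (simp add: bij_def)
  moreover have "C' (Q x) = scale c (Q (C x))" for x
    by (simp add: Q_def C'.scale P(5) mult.commute)
  moreover have "B (Q (C x)) (Q y) = B (C x) y" for x y
  proof -
    have "B (Q (C x)) (Q y) = (r * r * \<kappa>) * B (C x) y" by (simp add: Q_def form_simps P(6))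
    then show ?thesis by (simp add: r)
  qed
  ultimately show thesis using that linQ P(3) by blast
qed

text \<open>
  Here \<open>P\<close> must not be rescaled: it is already an isometry, because the normalising automorphism is
  one and \<open>X\<^sub>1\<close> is orthogonal to \<open>\<complex>X\<^sub>1 \<oplus> \<qq>\<close>.
\<close>

lemma isometric_intertwiner_of_i_iso:
  assumes skew: "skew_map scale B C" "skew_map scale B C'"
    and A: "dext_i_iso C C' A"
  obtains P c where "Vector_Spaces.linear scale scale P" "bij P" "c \<noteq> 0"
    "\<And>x. C' (P x) = scale c (P (C x))"
    "\<And>x y. B (P x) (P y) = B x y"
proof (cases "\<exists>u. C u \<noteq> 0")
  case False
  then have "C = (\<lambda>x. 0)" by auto
  then show thesis
    using that[of id 1] linear_id abelian_double_extension_rigid[OF skew(2), of A] A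
    by (simp add: i_iso_def)
next
  case True
  then obtain u where u: "C u \<noteq> 0" by blast
  have A': "dext_lie_iso C C' A"
    using A by (simp add: i_iso_def)
  obtain T \<gamma> where T: "dext_i_iso C' C' T"
    "(T \<circ> A) (1, 0, 0) = (\<gamma>, 0, 0)"
    using central_line_normalisation[OF skew A' u] by auto
  have TA: "dext_lie_iso C C' (T \<circ> A)"
    using lie_iso_comp A' T(1) by (auto simp: i_iso_def)
  obtain P c \<kappa> where P: "Vector_Spaces.linear scale scale P" "bij P" "c \<noteq> 0" "\<kappa> \<noteq> 0"
    "\<forall>x. C' (P x) = scale c (P (C x))"
    "\<forall>x y. B (P (C x)) (P y) = \<kappa> * B (C x) y"
    "\<forall>x. \<exists>g. (T \<circ> A) (0, 0, x) = (g, 0, P x)"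
    by (rule line_stabilizer_block_form[OF skew TA u T(2)]) (rule that)
  have "B (P x) (P y) = B x y" for x y
  proof -
    obtain g h where gh: "(T \<circ> A) (0, 0, x) = (g, 0, P x)" "(T \<circ> A) (0, 0, y) = (h, 0, P y)"
      using P(7) by blast
    have "dext_form B ((T \<circ> A) (0, 0, x)) ((T \<circ> A) (0, 0, y)) = B x y"
      using A T(1) by (simp add: i_iso_def del: split_paired_All)
    then show ?thesis unfolding gh by simp
  qed
  then show thesis using that P by blast
qed

end

theorem proposition5p5:
  fixes scale :: "complex \<Rightarrow> 'a::ab_group_add \<Rightarrow> 'a"
    and Basis :: "'a set"
    and B :: "'a \<Rightarrow> 'a \<Rightarrow> complex"
    and C C' :: "'a \<Rightarrow> 'a"
  assumes "quadratic_vector_space scale Basis B"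
    and "skew_map scale B C"
    and "skew_map scale B C'"
  shows "((\<exists>A. lie_iso (dext_scale scale) (dext_bracket scale B C)
                    (dext_scale scale) (dext_bracket scale B C') A)
          \<longleftrightarrow>
          (\<exists>P c. Vector_Spaces.linear scale scale P \<and> bij P \<and> c \<noteq> 0 \<and>
                 C' = (\<lambda>x. scale c (P (C (inv P x)))) \<and>
                 form_adjoint B P \<circ> P \<circ> C = C))
         \<and>
         ((\<exists>A. i_iso (dext_scale scale) (dext_bracket scale B C) (dext_form B)
                  (dext_scale scale) (dext_bracket scale B C') (dext_form B) A)
          \<longleftrightarrow>
          (\<exists>c. c \<noteq> 0 \<and> C' \<in> adjoint_orbit scale B (\<lambda>x. scale c (C x))))"
proof -
  interpret quadratic_vector_space scale Basis B by fact
  let ?lie = "\<lambda>A. lie_iso (dext_scale scale) (dext_bracket scale B C)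
                    (dext_scale scale) (dext_bracket scale B C') A"
  let ?i = "\<lambda>A. i_iso (dext_scale scale) (dext_bracket scale B C) (dext_form B)
                  (dext_scale scale) (dext_bracket scale B C') (dext_form B) A"
  have "(\<exists>A. ?lie A) \<longleftrightarrow>
      (\<exists>P c. Vector_Spaces.linear scale scale P \<and> bij P \<and> c \<noteq> 0 \<and>
         C' = (\<lambda>x. scale c (P (C (inv P x)))) \<and> form_adjoint B P \<circ> P \<circ> C = C)"
    (is "_ \<longleftrightarrow> ?R")
  proof
    assume "\<exists>A. ?lie A"
    then obtain A where "?lie A" by blast
    from intertwiner_of_lie_iso[OF assms(2,3) this]
    obtain P c where P: "Vector_Spaces.linear scale scale P" "bij P" "c \<noteq> 0"
      and eq: "\<And>x. C' (P x) = scale c (P (C x))" "\<And>x y. B (P (C x)) (P y) = B (C x) y"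
      by blast
    from eq have "C' = (\<lambda>x. scale c (P (C (inv P x))))" "form_adjoint B P \<circ> P \<circ> C = C"
      unfolding conjugate_iff_intertwines[OF P(2)] adjoint_comp_fixes_iff[OF P(1)] by blast+
    with P show ?R by blast
  next
    assume ?R
    then obtain P c where P: "Vector_Spaces.linear scale scale P" "bij P" "c \<noteq> 0"
      and eq: "C' = (\<lambda>x. scale c (P (C (inv P x))))" "form_adjoint B P \<circ> P \<circ> C = C"
      by blast
    show "\<exists>A. ?lie A"
      using lie_iso_of_intertwiner[OF P]
        eq[unfolded conjugate_iff_intertwines[OF P(2)] adjoint_comp_fixes_iff[OF P(1)]]
      by blast
  qed
  moreover have "(\<exists>A. ?i A) \<longleftrightarrow>
      (\<exists>c. c \<noteq> 0 \<and> C' \<in> adjoint_orbit scale B (\<lambda>x. scale c (C x)))"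
  proof
    assume "\<exists>A. ?i A"
    then obtain A where "?i A" by blast
    from isometric_intertwiner_of_i_iso[OF assms(2,3) this]
    show "\<exists>c. c \<noteq> 0 \<and> C' \<in> adjoint_orbit scale B (\<lambda>x. scale c (C x))"
      unfolding adjoint_orbit_scaled_iff by metis
  next
    assume "\<exists>c. c \<noteq> 0 \<and> C' \<in> adjoint_orbit scale B (\<lambda>x. scale c (C x))"
    then obtain c P where c: "c \<noteq> 0" and P: "Vector_Spaces.linear scale scale P" "bij P"
      "\<And>x y. B (P x) (P y) = B x y" "\<And>x. C' (P x) = scale c (P (C x))"
      unfolding adjoint_orbit_scaled_iff by blast
    let ?A = "\<lambda>(l, m, X). (c * l, m / c, P X)"
    have "dext_form B (?A x) (?A y) = dext_form B x y" for x y
      using c by (cases x; cases y) (simp add: P)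
    then have "?i ?A"
      using lie_iso_of_intertwiner[of P c C' C] P c by (simp add: i_iso_def)
    then show "\<exists>A. ?i A" by blast
  qed
  ultimately show ?thesis by blast
qed

end
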